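(* Let $R$ be a topological ring and let $X$ be a semitopological $R$-module. Let $\breve X$ be the Raĭkov completion of $X$ and let $\widetilde X\subseteq\breve X$ be the semitopological $R$-completion of $X$. Then $\widetilde X$ is a semitopological $R$-module having the following properties. (1) $\widetilde X$ is closed in any semitopological $R$-module $Y$ containing $\widetilde X$ (as an $R$-submodule with the subspace topology). (2) If $X$ is a topological $R$-module, then $\widetilde X=\breve X$, and $\widetilde X$ is a topological $R$-module. (3) If the additive topological group of $R$ is Baire and $\omega$-narrow, then the set $\widetilde X$ is sequentially closed in $\breve X$.
   Context: All topological spaces (hence all topological groups) are Tychonoff. A topological ring is a unital ring $R$ (not necessarily commutative) with a Hausdorff topology making addition and multiplication $R\times R\to R$ jointly continuous. An $R$-module is an Abelian group $X$ with a map $*:R\times X\to X$ such that $a*(x+y)=a*x+a*y$, $(a+b)*x=a*x+b*x$, $(ab)*x=a*(b*x)$, $1*x=x$. A right-topological $R$-module is an $R$-module $X$ with a Hausdorff topology making $X$ an Abelian topological group such that for every $a\in R$ the map $X\to X$, $x\mapsto a*x$, is continuous. It is a semitopological $R$-module if $*:R\times X\to X$ is separately continuous (i.e. additionally, for every $x\in X$ the map $R\to X$, $a\mapsto a*x$, is continuous), and a topological $R$-module if $*$ is jointly continuous. The Raĭkov completion $\breve X$ of a topological group $X$ is the complete topological group containing $X$ as a dense subgroup (the completion in the two-sided uniformity). If $X$ is a right-topological $R$-module, each map $x\mapsto a*x$ extends uniquely to a continuous homomorphism $\breve X\to\breve X$, and these extensions turn $\breve X$ into a right-topological $R$-module, with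 multiplication $\breve*:R\times\breve X\to\breve X$; this is called the Raĭkov completion of the module $X$. For a semitopological $R$-module $X$, its semitopological $R$-completion is the $R$-submodule $\widetilde X=\{x\in\breve X:\text{ the map }R\to\breve X,\ a\mapsto a\,\breve*\,x,\text{ is continuous}\}$ of $\breve X$, with the subspace topology; it contains $X$. A topological space is Baire if the intersection of any countable family of open dense subsets is dense. An (Abelian) topological group $G$ is $\omega$-narrow if for each neighborhood $U$ of the identity there is a countable $C\subseteq G$ with $G=C+U$. A subset $A$ of a space $S$ is sequentially closed in $S$ if the limit of every sequence of points of $A$ that converges in $S$ belongs to $A$. *)

theory Defs
  imports "HOL-Analysis.Analysis"
begin

text \<open>
  Topological rings are types of sort \<open>{ring, monoid_mult, topological_ab_group_add,
  topological_semigroup_mult, t2_space}\<close>: unital, not necessarily commutative, and (unlike with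
  \<open>ring_1\<close>) the zero ring is allowed. Hausdorff Abelian topological groups are types of sort
  \<open>{topological_ab_group_add, t2_space}\<close>; they are automatically Tychonoff.

  Modules have an explicit carrier \<open>S\<close>, an additive subgroup of a type, and carry the subspace
  topology. The library's \<open>module\<close> locales are not used since they need a commutative ring.
\<close>

definition left_module_on ::
    "'m::ab_group_add set \<Rightarrow> ('r::{ring, monoid_mult} \<Rightarrow> 'm \<Rightarrow> 'm) \<Rightarrow> bool" where
  "left_module_on S smul \<longleftrightarrow>
     0 \<in> S \<and> (\<forall>x\<in>S. \<forall>y\<in>S. x + y \<in> S) \<and> (\<forall>x\<in>S. - x \<in> S) \<and>
     (\<forall>a. \<forall>x\<in>S. smul a x \<in> S) \<and>
     (\<forall>a. \<forall>x\<in>S. \<forall>y\<in>S. smul a (x + y) = smul a x + smul a y) \<and>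
     (\<forall>a b. \<forall>x\<in>S. smul (a + b) x = smul a x + smul b x) \<and>
     (\<forall>a b. \<forall>x\<in>S. smul (a * b) x = smul a (smul b x)) \<and>
     (\<forall>x\<in>S. smul 1 x = x)"

definition right_topological_module_on ::
    "'m::{topological_ab_group_add, t2_space} set \<Rightarrow> ('r::{ring, monoid_mult} \<Rightarrow> 'm \<Rightarrow> 'm) \<Rightarrow> bool" where
  "right_topological_module_on S smul \<longleftrightarrow>
     left_module_on S smul \<and> (\<forall>a. continuous_on S (smul a))"

definition semitopological_module_on ::
    "'m::{topological_ab_group_add, t2_space} set \<Rightarrow>
     ('r::{ring, monoid_mult, topological_space} \<Rightarrow> 'm \<Rightarrow> 'm) \<Rightarrow> bool" where
  "semitopological_module_on S smul \<longleftrightarrow>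
     right_topological_module_on S smul \<and> (\<forall>x\<in>S. continuous_on UNIV (\<lambda>a. smul a x))"

definition topological_module_on ::
    "'m::{topological_ab_group_add, t2_space} set \<Rightarrow>
     ('r::{ring, monoid_mult, topological_space} \<Rightarrow> 'm \<Rightarrow> 'm) \<Rightarrow> bool" where
  "topological_module_on S smul \<longleftrightarrow>
     left_module_on S smul \<and> continuous_on (UNIV \<times> S) (\<lambda>(a, x). smul a x)"

definition topological_embedding_on ::
    "'a::topological_space set \<Rightarrow> ('a \<Rightarrow> 'b::topological_space) \<Rightarrow> bool" where
  "topological_embedding_on S j \<longleftrightarrow> (\<exists>g. homeomorphism S (j ` S) j g)"

text \<open>
  The type \<open>'c\<close> together with \<open>e\<close> is a Raikov completion of \<open>'x\<close>. The uniformity of a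
  \<open>uniform_topological_group_add\<close> type is necessarily the group uniformity (see
  \<open>uniformity = filtercomap (\<lambda>(x, y). y - x) (nhds 0)\<close> in \<open>Product_Vector\<close>), which for an Abelian
  group is the two-sided one. A completion is only determined up to isomorphism over \<open>'x\<close>, hence
  the predicate.
\<close>

definition raikov_completion ::
    "('x::{topological_ab_group_add, t2_space} \<Rightarrow>
      'c::{topological_ab_group_add, uniform_topological_group_add, t2_space}) \<Rightarrow> bool" where
  "raikov_completion e \<longleftrightarrow>
     complete (UNIV :: 'c set) \<and>
     (\<forall>x y. e (x + y) = e x + e y) \<and>
     topological_embedding_on UNIV e \<and>
     closure (range e) = UNIV"

text \<open>The multiplication of the completion: \<open>completion_smult e smul a\<close> is the unique continuous
  endomorphism extending \<open>smul a\<close> along \<open>e\<close>.\<close>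

definition completion_smult ::
    "('x \<Rightarrow> 'c::{ab_group_add, topological_space}) \<Rightarrow> ('r \<Rightarrow> 'x \<Rightarrow> 'x) \<Rightarrow> 'r \<Rightarrow> 'c \<Rightarrow> 'c" where
  "completion_smult e smul a =
     (THE g. (\<forall>u v. g (u + v) = g u + g v) \<and> continuous_on UNIV g \<and>
             (\<forall>x. g (e x) = e (smul a x)))"

definition semitopological_completion ::
    "('x \<Rightarrow> 'c::{ab_group_add, topological_space}) \<Rightarrow> ('r::topological_space \<Rightarrow> 'x \<Rightarrow> 'x) \<Rightarrow> 'c set" where
  "semitopological_completion e smul =
     {u. continuous_on UNIV (\<lambda>a. completion_smult e smul a u)}"

text \<open>\<open>j\<close> identifies the module on \<open>S\<close>, with its subspace topology, with a submodule of
  the module on \<open>T\<close>.\<close>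

definition submodule_embedding ::
    "'m::{topological_ab_group_add, t2_space} set \<Rightarrow> ('r \<Rightarrow> 'm \<Rightarrow> 'm) \<Rightarrow>
     'y::{topological_ab_group_add, t2_space} set \<Rightarrow> ('r \<Rightarrow> 'y \<Rightarrow> 'y) \<Rightarrow> ('m \<Rightarrow> 'y) \<Rightarrow> bool" where
  "submodule_embedding S smul T smul' j \<longleftrightarrow>
     j ` S \<subseteq> T \<and>
     (\<forall>u\<in>S. \<forall>v\<in>S. j (u + v) = j u + j v) \<and>
     (\<forall>a. \<forall>u\<in>S. j (smul a u) = smul' a (j u)) \<and>
     topological_embedding_on S j"

definition baire_space :: "'a::topological_space itself \<Rightarrow> bool" where
  "baire_space (_ :: 'a itself) \<longleftrightarrow>
     (\<forall>\<G> :: 'a set set. countable \<G> \<longrightarrow> (\<forall>G\<in>\<G>. open G \<and> closure G = UNIV) \<longrightarrow>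
        closure (\<Inter>\<G>) = UNIV)"

definition omega_narrow :: "'a::topological_ab_group_add itself \<Rightarrow> bool" where
  "omega_narrow (_ :: 'a itself) \<longleftrightarrow>
     (\<forall>U :: 'a set. 0 \<in> interior U \<longrightarrow>
        (\<exists>C. countable C \<and> {c + u | c u. c \<in> C \<and> u \<in> U} = UNIV))"

definition sequentially_closed :: "'a::topological_space set \<Rightarrow> bool" where
  "sequentially_closed A \<longleftrightarrow>
     (\<forall>s l. (\<forall>n. s n \<in> A) \<longrightarrow> s \<longlonglongrightarrow> l \<longrightarrow> l \<in> A)"

end

theory Submission
  imports Defs
begin

text \<open>
  Write \<open>C\<close> for the completion of the module \<open>X\<close>, \<open>a \<star> u\<close> for the
  multiplication on it, and \<open>S\<close> for the semitopological completion, the set of those \<open>u\<close> for which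
  the orbit map \<open>a \<mapsto> a \<star> u\<close> is continuous. Everything rests on the principle that a
  continuous homomorphism from a subgroup \<open>A\<close> into a complete group extends continuously, and as a
  homomorphism, to the closure of \<open>A\<close> (\<open>continuous_group_hom_extension\<close>). Extending from the dense
  image of \<open>X\<close> gives the multiplication on \<open>C\<close>, and every module identity passes from \<open>X\<close> to
  \<open>C\<close> because two continuous maps that agree on a dense set are equal. Since
  \<open>b \<star> (a \<star> u) = (b * a) \<star> u\<close>, the set \<open>S\<close> is a submodule.

  For closedness of \<open>S\<close> in a larger semitopological module \<open>Y\<close>, the inverse of the embedding of \<open>S\<close>
  is extended to a map \<open>g\<close> from the closure of \<open>S\<close> in \<open>Y\<close> to \<open>C\<close>. By density \<open>g\<close> is linear, so
  the orbit map of \<open>g y\<close> is \<open>g\<close> composed with the continuous orbit map of \<open>y\<close> in \<open>Y\<close>; hence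
  \<open>g y\<close> lies in \<open>S\<close>. Then \<open>g\<close> followed by the embedding is defined and continuous on the closure
  and is the identity on a dense subset, so each \<open>y\<close> in the closure is the image of \<open>g y\<close>.

  If \<open>X\<close> is a topological module, joint continuity at \<open>(0, 0)\<close> survives the passage to \<open>C\<close>, because
  zero has a base of closed neighbourhoods
  (\<open>cmult_jointly_continuous_at_zero\<close>). For \<open>u\<close> in \<open>C\<close> and \<open>x\<close> in \<open>X\<close> close to \<open>u\<close>, the
  splitting \<open>a \<star> u = a \<star> x - a \<star> (x - u)\<close> then shows that all orbit maps are
  continuous, and a separately continuous biadditive map that is continuous at \<open>(0, 0)\<close> is jointly
  continuous (\<open>continuous_on_biadditiveI\<close>).

  If a sequence in \<open>S\<close> converges in \<open>C\<close>, its orbit maps are continuous homomorphisms on the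
  additive group of the ring that converge pointwise to the orbit map of the limit. By a Baire category
  argument in the style of Osgood and Banach--Steinhaus, a pointwise limit of continuous homomorphisms
  on a Baire group is continuous (\<open>baire_pointwise_limit_continuous\<close>).
\<close>

section \<open>Homomorphisms on subgroups of topological groups\<close>

text \<open>
  Being a subgroup is part of the predicate, since here \<open>H\<close> is an embedded copy of a group or
  its closure, and closedness under differences is needed each time additivity is used.
\<close>

definition group_hom_on :: "'a::ab_group_add set \<Rightarrow> ('a \<Rightarrow> 'b::ab_group_add) \<Rightarrow> bool" where
  "group_hom_on H f \<longleftrightarrow> 0 \<in> H \<and> (\<forall>x\<in>H. \<forall>y\<in>H. x - y \<in> H \<and> f (x - y) = f x - f y)"

lemma group_hom_onI:
  assumes "0 \<in> H" "\<And>x y. x \<in> H \<Longrightarrow> y \<in> H \<Longrightarrow> x + y \<in> H" "\<And>x. x \<in> H \<Longrightarrow> - x \<in> H"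
    and "\<And>x y. x \<in> H \<Longrightarrow> y \<in> H \<Longrightarrow> f (x + y) = f x + f y"
  shows "group_hom_on H f"
  unfolding group_hom_on_def
proof (intro conjI ballI)
  fix x y assume xy: "x \<in> H" "y \<in> H"
  show diff: "x - y \<in> H"
    using assms(2)[OF xy(1) assms(3)[OF xy(2)]] by simp
  show "f (x - y) = f x - f y"
    using assms(4)[OF diff xy(2)] by simp
qed fact

lemma group_hom_onD:
  assumes "group_hom_on H f"
  shows "0 \<in> H" "f 0 = 0"
    and "x \<in> H \<Longrightarrow> y \<in> H \<Longrightarrow> x - y \<in> H" "x \<in> H \<Longrightarrow> y \<in> H \<Longrightarrow> f (x - y) = f x - f y"
    and "x \<in> H \<Longrightarrow> - x \<in> H" "x \<in> H \<Longrightarrow> f (- x) = - f x"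
    and "x \<in> H \<Longrightarrow> y \<in> H \<Longrightarrow> x + y \<in> H" "x \<in> H \<Longrightarrow> y \<in> H \<Longrightarrow> f (x + y) = f x + f y"
proof -
  show zero: "0 \<in> H"
    and diff: "\<And>x y. x \<in> H \<Longrightarrow> y \<in> H \<Longrightarrow> x - y \<in> H"
    and f_diff: "\<And>x y. x \<in> H \<Longrightarrow> y \<in> H \<Longrightarrow> f (x - y) = f x - f y"
    using assms by (auto simp: group_hom_on_def)
  show f_zero: "f 0 = 0"
    using f_diff[OF zero zero] by simp
  show minus: "\<And>x. x \<in> H \<Longrightarrow> - x \<in> H" and f_minus: "\<And>x. x \<in> H \<Longrightarrow> f (- x) = - f x"
    using diff[OF zero] f_diff[OF zero] f_zero by auto
  show "x \<in> H \<Longrightarrow> y \<in> H \<Longrightarrow> x + y \<in> H" "x \<in> H \<Longrightarrow> y \<in> H \<Longrightarrow> f (x + y) = f x + f y"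
    using diff[of x "- y"] f_diff[of x "- y"] minus f_minus by auto
qed

lemma open_translation_preimage:
  fixes U :: "'a::topological_ab_group_add set"
  assumes "open U"
  shows "open {x. x - c \<in> U}" "open {x. c + x \<in> U}"
proof -
  have "continuous_on UNIV (\<lambda>x. x - c)" "continuous_on UNIV (\<lambda>x. c + x)"
    by (intro continuous_on_diff continuous_on_add continuous_on_id continuous_on_const)+
  then show "open {x. x - c \<in> U}" "open {x. c + x \<in> U}"
    using open_vimage[OF assms] by (auto simp: vimage_def)
qed

text \<open>
  A neighbourhood of \<open>x\<close> is a translate of one of zero, and homomorphisms turn translations into
  translations.
\<close>

lemma continuous_on_group_homI:
  fixes f :: "'a::topological_ab_group_add \<Rightarrow> 'b::topological_ab_group_add"
  assumes hom: "group_hom_on H f"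
    and at_zero: "\<And>U. open U \<Longrightarrow> 0 \<in> U \<Longrightarrow> \<exists>N. open N \<and> 0 \<in> N \<and> (\<forall>x\<in>N \<inter> H. f x \<in> U)"
  shows "continuous_on H f"
  unfolding continuous_on_topological
proof (intro ballI allI impI)
  fix x B assume x: "x \<in> H" and B: "open B" "f x \<in> B"
  obtain N where N: "open N" "0 \<in> N" "\<forall>y\<in>N \<inter> H. f y \<in> {w. f x + w \<in> B}"
    using at_zero[OF open_translation_preimage(2)[OF B(1), of "f x"]] B(2) by auto
  show "\<exists>A. open A \<and> x \<in> A \<and> (\<forall>y\<in>H. y \<in> A \<longrightarrow> f y \<in> B)"
  proof (intro exI[of _ "{y. y - x \<in> N}"] conjI ballI impI)
    show "open {y. y - x \<in> N}" by (rule open_translation_preimage[OF N(1)])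
    fix y assume y: "y \<in> H" "y \<in> {y. y - x \<in> N}"
    then have "f x + f (y - x) \<in> B"
      using N(3) group_hom_onD(3)[OF hom y(1) x] by auto
    then show "f y \<in> B"
      using group_hom_onD(4)[OF hom y(1) x] by simp
  qed (use N(2) in simp)
qed

lemma zero_neighborhood_diff:
  fixes U :: "'a::topological_ab_group_add set"
  assumes "open U" "0 \<in> U"
  obtains V where "open V" "0 \<in> V" "\<forall>x\<in>V. \<forall>y\<in>V. x - y \<in> U"
proof -
  have "((\<lambda>p. fst p - snd p) \<longlongrightarrow> 0 - 0) (nhds (0::'a) \<times>\<^sub>F nhds (0::'a))"
    by (intro tendsto_diff filterlim_fst filterlim_snd)
  then have "\<forall>\<^sub>F p in nhds (0::'a) \<times>\<^sub>F nhds (0::'a). fst p - snd p \<in> U"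
    using assms by (simp add: tendsto_def)
  then obtain Q where Q: "eventually Q (nhds (0::'a))" "\<And>x y. Q x \<Longrightarrow> Q y \<Longrightarrow> x - y \<in> U"
    unfolding eventually_prod_same by auto
  then show thesis
    using that unfolding eventually_nhds by metis
qed

text \<open>
  Regularity of topological groups: if \<open>V - V \<subseteq> W\<close>, then every point of the closure of \<open>V\<close> is a
  difference of two points of \<open>V\<close>. Applying this inside a \<open>W\<close> with \<open>W - W \<subseteq> U\<close> controls the
  differences of points of the closure as well.
\<close>

lemma zero_neighborhood_closure:
  fixes U :: "'a::topological_ab_group_add set"
  assumes "open U" "0 \<in> U"
  obtains V where "open V" "0 \<in> V" "closure V \<subseteq> U"
    "\<forall>x\<in>closure V. \<forall>y\<in>closure V. x - y \<in> U"
proof -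
  obtain W where W: "open W" "0 \<in> W" "\<forall>x\<in>W. \<forall>y\<in>W. x - y \<in> U"
    by (rule zero_neighborhood_diff[OF assms])
  obtain V where V: "open V" "0 \<in> V" "\<forall>x\<in>V. \<forall>y\<in>V. x - y \<in> W"
    by (rule zero_neighborhood_diff[OF W(1,2)])
  have cl: "closure V \<subseteq> W"
  proof
    fix x assume "x \<in> closure V"
    moreover have "open {y. y - x \<in> V}" "x \<in> {y. y - x \<in> V}"
      using open_translation_preimage(1)[OF V(1)] V(2) by auto
    ultimately obtain y where "y \<in> V" "y - x \<in> V"
      unfolding closure_iff_nhds_not_empty by blast
    then show "x \<in> W"
      using V(3) by (force dest: bspec[of V _ y] bspec[of V _ "y - x"])
  qed
  moreover have "W \<subseteq> U"
    using W(2,3) by force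
  ultimately show thesis
    using that[OF V(1,2)] W(3) by blast
qed

lemma continuous_agree_on_dense:
  fixes f g :: "'a::topological_space \<Rightarrow> 'b::t2_space"
  assumes "continuous_on (closure A) f" "continuous_on (closure A) g"
    and "\<And>x. x \<in> A \<Longrightarrow> f x = g x" "x \<in> closure A"
  shows "f x = g x"
proof -
  \<comment> \<open>the pair of the two maps sends the dense set into the diagonal, which is closed\<close>
  have "continuous_on (closure A) (\<lambda>x. (f x, g x))"
    using assms by (intro continuous_on_Pair)
  then have "(\<lambda>x. (f x, g x)) ` closure A \<subseteq> {(u, v). u = v}"
    using assms(3)
    by (intro image_closure_subset) (auto simp: closed_diagonal split_def closed_Collect_eq
      continuous_on_fst continuous_on_snd)
  then show ?thesis
    using assms(4) by auto
qed

lemma closure_subgroup_diff: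
  fixes A :: "'a::topological_ab_group_add set"
  assumes "\<And>x y. x \<in> A \<Longrightarrow> y \<in> A \<Longrightarrow> x - y \<in> A" "x \<in> closure A" "y \<in> closure A"
  shows "x - y \<in> closure A"
proof -
  have "continuous_on (closure (A \<times> A)) (\<lambda>p. fst p - snd p)"
    by (intro continuous_on_diff continuous_on_fst continuous_on_snd continuous_on_id)
  then have "(\<lambda>p. fst p - snd p) ` closure (A \<times> A) \<subseteq> closure A"
    using assms(1) by (intro image_closure_subset) (auto intro: subsetD[OF closure_subset])
  then show ?thesis
    using assms(2,3) by (force simp: closure_Times)
qed

section \<open>Extension to the closure of a subgroup\<close>

abbreviation nhds_trace :: "'a::topological_space set \<Rightarrow> 'a \<Rightarrow> 'a filter" where
  "nhds_trace A y \<equiv> inf (nhds y) (principal A)"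

lemma nhds_trace_nontrivial: "y \<in> closure A \<Longrightarrow> nhds_trace A y \<noteq> bot"
  by (auto simp: trivial_limit_def eventually_inf_principal eventually_nhds
      closure_iff_nhds_not_empty)

lemma tendsto_nhds_trace:
  assumes "continuous_on A h" "y \<in> A"
  shows "(h \<longlongrightarrow> h y) (nhds_trace A y)"
  using assms tendsto_at_within_iff_tendsto_nhds[of h y A] unfolding continuous_on_def by metis

text \<open>
  As \<open>p\<close> and \<open>q\<close> tend to \<open>y\<close> and \<open>z\<close> inside \<open>A\<close>, the difference \<open>p - q\<close> tends to \<open>y - z\<close> and
  stays in \<open>A\<close>. With \<open>y = z\<close> this yields the Cauchy property of the images, and with arbitrary
  \<open>y\<close> and \<open>z\<close> the additivity of the extension.
\<close>

lemma group_hom_diff_nhds_trace: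
  fixes h :: "'a::topological_ab_group_add \<Rightarrow> 'b::topological_ab_group_add"
  assumes hom: "group_hom_on A h" and lim: "(h \<longlongrightarrow> l) (nhds_trace A (y - z))"
  shows "((\<lambda>p. h (fst p) - h (snd p)) \<longlongrightarrow> l) (nhds_trace A y \<times>\<^sub>F nhds_trace A z)"
proof -
  let ?F = "nhds_trace A y \<times>\<^sub>F nhds_trace A z"
  have ident: "((\<lambda>x. x) \<longlongrightarrow> x) (nhds_trace A x)" for x
    by (auto simp: filterlim_def le_infI1)
  have in_A: "\<forall>\<^sub>F p in ?F. fst p \<in> A \<and> snd p \<in> A"
    unfolding eventually_prod_filter
    by (intro exI[of _ "\<lambda>x. x \<in> A"]) (auto simp: eventually_inf_principal)
  have "((\<lambda>p. fst p - snd p) \<longlongrightarrow> y - z) ?F"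
    by (intro tendsto_diff filterlim_compose[OF ident filterlim_fst]
        filterlim_compose[OF ident filterlim_snd])
  then have "filterlim (\<lambda>p. fst p - snd p) (nhds_trace A (y - z)) ?F"
    unfolding filterlim_inf filterlim_principal
    using in_A by (auto elim!: eventually_mono intro: group_hom_onD(3)[OF hom])
  then have "((\<lambda>p. h (fst p - snd p)) \<longlongrightarrow> l) ?F"
    by (rule filterlim_compose[OF lim])
  then show ?thesis
    by (rule Lim_transform_eventually)
       (use in_A in \<open>auto elim!: eventually_mono simp: group_hom_onD(4)[OF hom]\<close>)
qed

text \<open>
  The image of the trace filter is a Cauchy filter, because the uniformity consists of the
  preimages of neighbourhoods of zero under the difference map.
\<close>

lemma tendsto_extension_value:
  fixes h :: "'a::topological_ab_group_add \<Rightarrow>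
    'c::{topological_ab_group_add, uniform_topological_group_add, t2_space}"
  assumes hom: "group_hom_on A h" and cont: "continuous_on A h"
    and complete: "complete (UNIV :: 'c set)" and y: "y \<in> closure A"
  shows "\<exists>z. (h \<longlongrightarrow> z) (nhds_trace A y)"
proof -
  let ?F = "nhds_trace A y"
  have "(h \<longlongrightarrow> 0) (nhds_trace A (y - y))"
    using tendsto_nhds_trace[OF cont group_hom_onD(1)[OF hom]] group_hom_onD(2)[OF hom] by simp
  then have "((\<lambda>p. h (fst p) - h (snd p)) \<longlongrightarrow> 0) (?F \<times>\<^sub>F ?F)"
    by (rule group_hom_diff_nhds_trace[OF hom])
  from filterlim_compose[OF this filterlim_Pair[OF filterlim_snd filterlim_fst]]
  have "((\<lambda>p. h (snd p) - h (fst p)) \<longlongrightarrow> 0) (?F \<times>\<^sub>F ?F)"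
    by simp
  then have "cauchy_filter (filtermap h ?F)"
    unfolding cauchy_filter_def cauchy_seq_finset_iff_vanishing prod_filtermap1 prod_filtermap2
    by (simp add: filterlim_def filtermap_le_iff_le_filtercomap filtermap_filtermap
      filtercomap_filtercomap split_def)
  then show ?thesis
    using cauchy_filter_complete_converges[OF _ complete, of "filtermap h ?F"]
      nhds_trace_nontrivial[OF y]
    by (auto simp: filterlim_def filtermap_bot_iff)
qed

text \<open>
  The extension is the limit along the trace filters. Since it is a homomorphism, its continuity
  has to be checked at zero only, where a closed neighbourhood that contains the values on \<open>A\<close> contains
  their limits too.
\<close>

lemma continuous_group_hom_extension:
  fixes h :: "'a::topological_ab_group_add \<Rightarrow>
    'c::{topological_ab_group_add, uniform_topological_group_add, t2_space}"
  assumes hom: "group_hom_on A h" and cont: "continuous_on A h"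
    and complete: "complete (UNIV :: 'c set)"
  obtains g where "group_hom_on (closure A) g" "continuous_on (closure A) g"
    "\<And>x. x \<in> A \<Longrightarrow> g x = h x"
proof -
  obtain g where g: "\<And>y. y \<in> closure A \<Longrightarrow> (h \<longlongrightarrow> g y) (nhds_trace A y)"
    using tendsto_extension_value[OF hom cont complete] by metis
  have agree: "g x = h x" if "x \<in> A" for x
    using tendsto_unique[OF nhds_trace_nontrivial g tendsto_nhds_trace[OF cont that]]
      subsetD[OF closure_subset that] by blast
  have hom_g: "group_hom_on (closure A) g"
    unfolding group_hom_on_def
  proof (intro conjI ballI)
    show "0 \<in> closure A"
      using group_hom_onD(1)[OF hom] closure_subset by blast
    fix y z assume yz: "y \<in> closure A" "z \<in> closure A"
    show diff: "y - z \<in> closure A"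
      by (rule closure_subgroup_diff[OF group_hom_onD(3)[OF hom] yz])
    let ?F = "nhds_trace A y \<times>\<^sub>F nhds_trace A z"
    have "((\<lambda>p. h (fst p) - h (snd p)) \<longlongrightarrow> g y - g z) ?F"
      by (intro tendsto_diff filterlim_compose[OF g[OF yz(1)] filterlim_fst]
          filterlim_compose[OF g[OF yz(2)] filterlim_snd])
    moreover have "?F \<noteq> bot"
      using nhds_trace_nontrivial yz by (auto simp: prod_filter_eq_bot)
    ultimately show "g (y - z) = g y - g z"
      using tendsto_unique group_hom_diff_nhds_trace[OF hom g[OF diff]] by blast
  qed
  moreover have "continuous_on (closure A) g"
  proof (rule continuous_on_group_homI[OF hom_g])
    fix U :: "'c set" assume U: "open U" "0 \<in> U"
    obtain V where V: "open V" "0 \<in> V" "closure V \<subseteq> U"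
      by (rule zero_neighborhood_closure[OF U])
    have "h 0 \<in> V" "0 \<in> A"
      using group_hom_onD(1,2)[OF hom] V(2) by auto
    then obtain N where N: "open N" "0 \<in> N" "\<forall>x\<in>A. x \<in> N \<longrightarrow> h x \<in> V"
      using cont V(1) unfolding continuous_on_topological by blast
    have "g y \<in> closure V" if y: "y \<in> N \<inter> closure A" for y
    proof (rule Lim_in_closed_set[OF closed_closure _ nhds_trace_nontrivial g])
      have "\<forall>\<^sub>F x in nhds y. x \<in> A \<longrightarrow> h x \<in> V"
        using N(1,3) y unfolding eventually_nhds by blast
      then show "\<forall>\<^sub>F x in nhds_trace A y. h x \<in> closure V"
        unfolding eventually_inf_principal
        by (auto elim!: eventually_mono intro: subsetD[OF closure_subset])
    qed (use y in auto)
    then show "\<exists>N. open N \<and> 0 \<in> N \<and> (\<forall>x\<in>N \<inter> closure A. g x \<in> U)"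
      using N(1,2) V(3) by blast
  qed
  ultimately show thesis
    using that agree by blast
qed

section \<open>Joint continuity of biadditive maps\<close>

lemma group_hom_on_UNIV:
  "(\<And>x y. f (x + y) = f x + f y) \<Longrightarrow> group_hom_on UNIV f"
  by (rule group_hom_onI) auto

text \<open>
  Near \<open>(a0, u0)\<close> expand
  \<open>m a u = m (a - a0) (u - u0) + m a u0 + (m a0 u - m a0 u0)\<close>: the first summand is controlled by
  continuity at \<open>(0, 0)\<close>, the others by separate continuity.
\<close>

lemma continuous_on_biadditiveI:
  fixes m :: "'a::topological_ab_group_add \<Rightarrow> 'b::topological_ab_group_add \<Rightarrow>
    'c::topological_ab_group_add"
  assumes left: "\<And>u. group_hom_on UNIV (\<lambda>a. m a u)" "\<And>u. continuous_on UNIV (\<lambda>a. m a u)"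
    and right: "\<And>a. group_hom_on UNIV (m a)" "\<And>a. continuous_on UNIV (m a)"
    and at_zero: "\<And>U. open U \<Longrightarrow> 0 \<in> U \<Longrightarrow>
      \<exists>V W. open V \<and> 0 \<in> V \<and> open W \<and> 0 \<in> W \<and> (\<forall>a\<in>V. \<forall>u\<in>W. m a u \<in> U)"
  shows "continuous_on UNIV (\<lambda>(a, u). m a u)"
  unfolding continuous_on_def
proof
  fix p0 :: "'a \<times> 'b"
  obtain a0 u0 where p0: "p0 = (a0, u0)" by (cases p0)
  have fst: "(fst \<longlongrightarrow> a0) (at p0)" and snd: "(snd \<longlongrightarrow> u0) (at p0)"
    unfolding p0 using tendsto_fst[OF tendsto_ident_at, of "(a0, u0)" UNIV]
      tendsto_snd[OF tendsto_ident_at, of "(a0, u0)" UNIV] by auto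
  have lim: "((\<lambda>p. fst p - a0) \<longlongrightarrow> 0) (at p0)" "((\<lambda>p. snd p - u0) \<longlongrightarrow> 0) (at p0)"
    using tendsto_diff[OF fst tendsto_const[of a0]] tendsto_diff[OF snd tendsto_const[of u0]]
    by auto
  have "((\<lambda>p. m (fst p - a0) (snd p - u0)) \<longlongrightarrow> 0) (at p0)"
  proof (rule topological_tendstoI)
    fix U :: "'c set" assume "open U" "0 \<in> U"
    then obtain V W where VW: "open V" "0 \<in> V" "open W" "0 \<in> W" "\<forall>a\<in>V. \<forall>u\<in>W. m a u \<in> U"
      using at_zero by metis
    show "\<forall>\<^sub>F p in at p0. m (fst p - a0) (snd p - u0) \<in> U"
      using topological_tendstoD[OF lim(1) VW(1,2)] topological_tendstoD[OF lim(2) VW(3,4)]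
      by eventually_elim (use VW(5) in auto)
  qed
  moreover have "((\<lambda>p. m (fst p) u0) \<longlongrightarrow> m a0 u0) (at p0)"
    by (rule continuous_on_tendsto_compose[OF left(2) fst]) auto
  moreover have "((\<lambda>p. m a0 (snd p)) \<longlongrightarrow> m a0 u0) (at p0)"
    by (rule continuous_on_tendsto_compose[OF right(2) snd]) auto
  ultimately have
    "((\<lambda>p. m (fst p - a0) (snd p - u0) + m (fst p) u0 + (m a0 (snd p) - m a0 u0)) \<longlongrightarrow>
      0 + m a0 u0 + (m a0 u0 - m a0 u0)) (at p0)"
    by (intro tendsto_add tendsto_diff tendsto_const)
  moreover have "m (a - a0) (u - u0) + m a u0 + (m a0 u - m a0 u0) = m a u" for a u
    using group_hom_onD(4)[OF left(1)] group_hom_onD(4)[OF right(1)] by simp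
  ultimately show "((\<lambda>(a, u). m a u) \<longlongrightarrow> (case p0 of (a, u) \<Rightarrow> m a u)) (at p0)"
    by (simp add: p0 split_def)
qed

section \<open>Pointwise limits of homomorphisms on Baire groups\<close>

lemma baire_closed_cover_interior:
  fixes A :: "nat \<Rightarrow> 'a::topological_space set"
  assumes "baire_space TYPE('a)" "\<And>n. closed (A n)" "(\<Union>n. A n) = UNIV"
  shows "\<exists>n. interior (A n) \<noteq> {}"
proof (rule ccontr)
  assume "\<not> ?thesis"
  then have "\<forall>G\<in>range (\<lambda>n. - A n). open G \<and> closure G = UNIV"
    using assms(2) by (auto simp: closure_complement)
  then have "closure (\<Inter>(range (\<lambda>n. - A n))) = UNIV"
    using assms(1)[unfolded baire_space_def, THEN spec, of "range (\<lambda>n. - A n)"] by simp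
  moreover have "\<Inter>(range (\<lambda>n. - A n)) = {}"
    using assms(3) by auto
  ultimately show False
    by auto
qed

lemma pointwise_limit_group_hom:
  fixes f :: "nat \<Rightarrow> 'a::ab_group_add \<Rightarrow> 'b::{topological_ab_group_add, t2_space}"
  assumes "\<And>n. group_hom_on UNIV (f n)" "\<And>a. (\<lambda>n. f n a) \<longlonglongrightarrow> g a"
  shows "group_hom_on UNIV g"
proof (rule group_hom_on_UNIV)
  fix x y
  have "(\<lambda>n. f n (x + y)) \<longlonglongrightarrow> g x + g y"
    using tendsto_add[OF assms(2)[of x] assms(2)[of y]] group_hom_onD(8)[OF assms(1)] by simp
  then show "g (x + y) = g x + g y"
    using assms(2) LIMSEQ_unique by blast
qed

text \<open>
  The closed sets \<open>A n\<close> on which the sequence moves by at most a small \<open>closure W\<close> after time \<open>n\<close> cover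
  the group, since the sequence is pointwise Cauchy. By the Baire property some \<open>A n\<close> contains a
  neighbourhood of a point \<open>a0\<close>, and translating by \<open>a0\<close> makes \<open>g\<close> uniformly close to the
  continuous \<open>f n\<close> near zero.
\<close>

lemma baire_pointwise_limit_continuous:
  fixes f :: "nat \<Rightarrow> 'a::topological_ab_group_add \<Rightarrow> 'b::{topological_ab_group_add, t2_space}"
  assumes baire: "baire_space TYPE('a)"
    and hom: "\<And>n. group_hom_on UNIV (f n)" and cont: "\<And>n. continuous_on UNIV (f n)"
    and lim: "\<And>a. (\<lambda>n. f n a) \<longlonglongrightarrow> g a"
  shows "continuous_on UNIV g"
proof (rule continuous_on_group_homI)
  show hom_g: "group_hom_on UNIV g"
    by (rule pointwise_limit_group_hom[OF hom lim])
  fix U :: "'b set" assume U: "open U" "0 \<in> U"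
  obtain V where V: "open V" "0 \<in> V" "\<forall>x\<in>V. \<forall>y\<in>V. x - y \<in> U"
    by (rule zero_neighborhood_diff[OF U])
  obtain W where W: "open W" "0 \<in> W" "closure W \<subseteq> V"
      "\<forall>x\<in>closure W. \<forall>y\<in>closure W. x - y \<in> V"
    by (rule zero_neighborhood_closure[OF V(1,2)])
  define A where "A n = {a. \<forall>k\<ge>n. f k a - f n a \<in> closure W}" for n
  have "closed (A n)" for n
  proof -
    have "A n = (\<Inter>k\<in>{n..}. (\<lambda>a. f k a - f n a) -` closure W)"
      by (auto simp: A_def)
    then show ?thesis
      using cont by (auto intro!: closed_INT closed_vimage continuous_on_diff)
  qed
  moreover have "a \<in> (\<Union>n. A n)" for a
  proof -
    have "((\<lambda>p. f (fst p) a - f (snd p) a) \<longlongrightarrow> g a - g a) (sequentially \<times>\<^sub>F sequentially)"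
      by (intro tendsto_diff filterlim_compose[OF lim] filterlim_fst filterlim_snd)
    then have "\<forall>\<^sub>F p in sequentially \<times>\<^sub>F sequentially. f (fst p) a - f (snd p) a \<in> W"
      using W(1,2) by (auto dest: topological_tendstoD)
    then show ?thesis
      using closure_subset[of W] unfolding eventually_prod_sequentially A_def by fastforce
  qed
  ultimately obtain n where "interior (A n) \<noteq> {}"
    using baire_closed_cover_interior[OF baire, of A] by blast
  then obtain a0 where a0: "a0 \<in> interior (A n)" by blast
  \<comment> \<open>on \<open>A n\<close> let \<open>k\<close> tend to infinity, staying in the closed set \<open>closure W\<close>\<close>
  have near: "g a - f n a \<in> closure W" if "a \<in> A n" for a
  proof (rule Lim_in_closed_set[OF closed_closure _ sequentially_bot])
    show "(\<lambda>k. f k a - f n a) \<longlonglongrightarrow> g a - f n a"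
      by (intro tendsto_diff lim tendsto_const)
    show "\<forall>\<^sub>F k in sequentially. f k a - f n a \<in> closure W"
      using that unfolding A_def eventually_sequentially by blast
  qed
  let ?N = "f n -` V \<inter> {v. a0 + v \<in> interior (A n)}"
  have "g v \<in> U" if v: "v \<in> ?N" for v
  proof -
    have "a0 + v \<in> A n" "a0 \<in> A n"
      using v a0 interior_subset by auto
    \<comment> \<open>this difference equals \<open>f n v - g v\<close>\<close>
    then have "(g a0 - f n a0) - (g (a0 + v) - f n (a0 + v)) \<in> V"
      using W(4) near by blast
    then have "f n v - ((g a0 - f n a0) - (g (a0 + v) - f n (a0 + v))) \<in> U"
      using v V(3) by blast
    then show ?thesis
      using group_hom_onD(8)[OF hom_g, of a0 v] group_hom_onD(8)[OF hom, of a0 v n] by simp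
  qed
  moreover have "open ?N"
    by (intro open_Int open_vimage[OF V(1)] cont open_translation_preimage(2) open_interior)
  moreover have "0 \<in> ?N"
    using a0 V(2) group_hom_onD(2)[OF hom] by simp
  ultimately show "\<exists>N. open N \<and> 0 \<in> N \<and> (\<forall>x\<in>N \<inter> UNIV. g x \<in> U)"
    by blast
qed

section \<open>The completion of a right-topological module\<close>

locale right_topological_module_completion =
  fixes smul :: "'r::{ring, monoid_mult, topological_ab_group_add, topological_semigroup_mult, t2_space}
                 \<Rightarrow> 'x::{topological_ab_group_add, t2_space} \<Rightarrow> 'x"
    and e :: "'x \<Rightarrow> 'c::{topological_ab_group_add, uniform_topological_group_add, t2_space}"
  assumes right_topological: "right_topological_module_on UNIV smul"
    and completion: "raikov_completion e"
begin

abbreviation cmult :: "'r \<Rightarrow> 'c \<Rightarrow> 'c" (infixr "\<star>" 75) where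
  "a \<star> u \<equiv> completion_smult e smul a u"

abbreviation semi_completion :: "'c set" where
  "semi_completion \<equiv> semitopological_completion e smul"

lemma smul_laws:
  "smul a (x + y) = smul a x + smul a y" "smul (a + b) x = smul a x + smul b x"
  "smul (a * b) x = smul a (smul b x)" "smul 1 x = x" "continuous_on UNIV (smul a)"
  using right_topological
  by (auto simp: right_topological_module_on_def left_module_on_def)

lemma completion_laws:
  "complete (UNIV :: 'c set)" "e (x + y) = e x + e y" "closure (range e) = UNIV"
  using completion by (auto simp: raikov_completion_def)

lemma embedding_inverse:
  obtains i where "\<And>x. i (e x) = x" "continuous_on (range e) i" "continuous_on UNIV e"
  using completion homeomorphism_apply1 homeomorphism_cont1 homeomorphism_cont2
  unfolding raikov_completion_def topological_embedding_on_def by (metis UNIV_I)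

lemma hom_e: "group_hom_on UNIV e"
  by (rule group_hom_on_UNIV) (rule completion_laws)

lemma eq_on_completionI:
  fixes f g :: "'c \<Rightarrow> 'd::t2_space"
  assumes "continuous_on UNIV f" "continuous_on UNIV g" "\<And>x. f (e x) = g (e x)"
  shows "f u = g u"
  using continuous_agree_on_dense[of "range e" f g u] assms completion_laws(3) by auto

text \<open>
  The definite description that defines the multiplication on the completion is meaningful:
  existence is the extension theorem for the dense subgroup \<open>range e\<close>, uniqueness is density.
\<close>

lemma continuous_endomorphism_extension:
  "\<exists>!g. (\<forall>u v. g (u + v) = g u + g v) \<and> continuous_on UNIV g \<and> (\<forall>x. g (e x) = e (smul a x))"
proof (rule ex_ex1I)
  obtain i where i: "\<And>x. i (e x) = x" "continuous_on (range e) i" "continuous_on UNIV e"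
    by (rule embedding_inverse) blast
  let ?h = "\<lambda>u. e (smul a (i u))"
  have "continuous_on (range e) ?h"
    using continuous_on_compose2[OF i(3) continuous_on_compose2[OF smul_laws(5)[of a] i(2)]]
    by auto
  moreover have "group_hom_on (range e) ?h"
  proof (rule group_hom_onI)
    show "0 \<in> range e"
      using group_hom_onD(2)[OF hom_e] by (metis rangeI)
    show "- u \<in> range e" if "u \<in> range e" for u
      using that group_hom_onD(6)[OF hom_e] by (metis UNIV_I imageE rangeI)
    fix u v assume "u \<in> range e" "v \<in> range e"
    then obtain x y where xy: "u = e x" "v = e y" by blast
    then have uv: "u + v = e (x + y)"
      by (simp add: completion_laws)
    then show "u + v \<in> range e" by blast
    show "?h (u + v) = ?h u + ?h v"
      unfolding uv unfolding xy i by (simp add: smul_laws completion_laws)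
  qed
  ultimately obtain g where "group_hom_on UNIV g" "continuous_on UNIV g"
      "\<And>u. u \<in> range e \<Longrightarrow> g u = ?h u"
    using continuous_group_hom_extension[of "range e" ?h] completion_laws(1,3) by metis
  then show "\<exists>g. (\<forall>u v. g (u + v) = g u + g v) \<and> continuous_on UNIV g \<and>
      (\<forall>x. g (e x) = e (smul a x))"
    using group_hom_onD(8)[of UNIV g] i(1) by (intro exI[of _ g]) auto
next
  fix g h :: "'c \<Rightarrow> 'c"
  assume "(\<forall>u v. g (u + v) = g u + g v) \<and> continuous_on UNIV g \<and> (\<forall>x. g (e x) = e (smul a x))"
    and "(\<forall>u v. h (u + v) = h u + h v) \<and> continuous_on UNIV h \<and> (\<forall>x. h (e x) = e (smul a x))"
  then show "g = h"
    using eq_on_completionI[of g h] by auto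
qed

lemma cmult_props:
  shows cmult_add_right: "a \<star> (u + v) = a \<star> u + a \<star> v"
    and cmult_continuous: "continuous_on UNIV ((\<star>) a)"
    and cmult_e: "a \<star> e x = e (smul a x)"
  using theI'[OF continuous_endomorphism_extension[of a]] unfolding completion_smult_def by blast+

lemma cmult_hom_right: "group_hom_on UNIV ((\<star>) a)"
  by (rule group_hom_on_UNIV) (rule cmult_add_right)

lemma cmult_continuous_compose:
  "continuous_on S f \<Longrightarrow> continuous_on S (\<lambda>u. a \<star> f u)"
  by (rule continuous_on_compose2[OF cmult_continuous]) auto

lemma cmult_add_left: "(a + b) \<star> u = a \<star> u + b \<star> u"
  by (rule eq_on_completionI[of "(\<star>) (a + b)" "\<lambda>u. a \<star> u + b \<star> u"])
     (auto intro: cmult_continuous continuous_on_add simp: cmult_e smul_laws completion_laws)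

lemma cmult_assoc: "(a * b) \<star> u = a \<star> b \<star> u"
  by (rule eq_on_completionI[of "(\<star>) (a * b)" "\<lambda>u. a \<star> b \<star> u"])
     (auto intro: cmult_continuous cmult_continuous_compose simp: cmult_e smul_laws)

lemma cmult_one: "1 \<star> u = u"
  by (rule eq_on_completionI[of "(\<star>) 1" "\<lambda>u. u"])
     (auto intro: cmult_continuous simp: cmult_e smul_laws)

lemma cmult_hom_left: "group_hom_on UNIV (\<lambda>a. a \<star> u)"
  by (rule group_hom_on_UNIV) (rule cmult_add_left)

lemma left_module_on_UNIV: "left_module_on UNIV (completion_smult e smul)"
  unfolding left_module_on_def
  using cmult_add_left cmult_add_right cmult_assoc cmult_one by auto

lemma mem_semi_completion: "u \<in> semi_completion \<longleftrightarrow> continuous_on UNIV (\<lambda>a. a \<star> u)"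
  by (simp add: semitopological_completion_def)

text \<open>
  By associativity the orbit map of \<open>a \<star> u\<close> is the orbit map of \<open>u\<close> after right multiplication
  by \<open>a\<close>, which is continuous on the ring.
\<close>

lemma cmult_mem_semi_completion:
  assumes "u \<in> semi_completion"
  shows "a \<star> u \<in> semi_completion"
proof -
  have "continuous_on UNIV (\<lambda>b::'r. b * a)"
    unfolding continuous_on_def by (intro ballI tendsto_mult tendsto_ident_at tendsto_const)
  then have "continuous_on UNIV (\<lambda>b. (b * a) \<star> u)"
    using assms continuous_on_compose2[of UNIV "\<lambda>b. b \<star> u" UNIV "\<lambda>b. b * a"]
    by (simp add: mem_semi_completion)
  then show ?thesis
    by (simp add: mem_semi_completion cmult_assoc)
qed

lemma group_hom_on_semi_completion:
  assumes "\<And>u v. u \<in> semi_completion \<Longrightarrow> v \<in> semi_completion \<Longrightarrow> f (u + v) = f u + f v"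
  shows "group_hom_on semi_completion f"
  using assms group_hom_onD(2,6)[OF cmult_hom_right]
  by (intro group_hom_onI)
     (auto simp: mem_semi_completion cmult_add_right intro: continuous_on_add continuous_on_minus)

theorem semitopological_completion_is_semitopological:
  "semitopological_module_on semi_completion (completion_smult e smul)"
proof -
  have "group_hom_on semi_completion (\<lambda>u. u)"
    by (rule group_hom_on_semi_completion) simp
  then have "left_module_on semi_completion (completion_smult e smul)"
    unfolding left_module_on_def
    using group_hom_onD(1,5,7) cmult_mem_semi_completion
    by (auto simp: cmult_add_right cmult_add_left cmult_assoc cmult_one)
  then show ?thesis
    unfolding semitopological_module_on_def right_topological_module_on_def
    using cmult_continuous continuous_on_subset mem_semi_completion by blast
qed

text \<open>
  A point \<open>y\<close> of the closure determines, by extending the inverse of \<open>j\<close>, a point \<open>g y\<close> of the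
  completion. The essential point is that \<open>g y\<close> has a continuous orbit map, which it inherits from \<open>y\<close>
  through the linearity of \<open>g\<close>. Only then is \<open>j (g y)\<close> under control, and it must be \<open>y\<close>.
\<close>

theorem semitopological_completion_closed:
  fixes smul' :: "'r \<Rightarrow> 'y::{topological_ab_group_add, t2_space} \<Rightarrow> 'y"
  assumes semi: "semitopological_module_on UNIV smul'"
    and emb: "submodule_embedding semi_completion (completion_smult e smul) UNIV smul' j"
  shows "closed (j ` semi_completion)"
proof -
  let ?A = "j ` semi_completion"
  have j_add: "\<And>u v. u \<in> semi_completion \<Longrightarrow> v \<in> semi_completion \<Longrightarrow> j (u + v) = j u + j v"
    and j_smul: "\<And>a u. u \<in> semi_completion \<Longrightarrow> smul' a (j u) = j (a \<star> u)"
    using emb unfolding submodule_embedding_def by auto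
  obtain i where i: "homeomorphism semi_completion ?A j i"
    using emb unfolding submodule_embedding_def topological_embedding_on_def by blast
  have i_j: "i (j u) = u" if "u \<in> semi_completion" for u
    using homeomorphism_apply1[OF i that] .
  have hom_j: "group_hom_on semi_completion j"
    by (rule group_hom_on_semi_completion[OF j_add])
  have hom_i: "group_hom_on ?A i"
  proof (rule group_hom_onI)
    show "0 \<in> ?A"
      using group_hom_onD(1,2)[OF hom_j] by (intro image_eqI[of _ _ 0]) auto
    show "- y \<in> ?A" if "y \<in> ?A" for y
    proof -
      from that obtain u where "u \<in> semi_completion" "y = j u" by blast
      then show ?thesis
        using group_hom_onD(5,6)[OF hom_j] by (intro image_eqI[of _ _ "- u"]) auto
    qed
    fix y z assume "y \<in> ?A" "z \<in> ?A"
    then obtain u v where uv: "u \<in> semi_completion" "v \<in> semi_completion" "y = j u" "z = j v"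
      by blast
    then have yz: "y + z = j (u + v)" "u + v \<in> semi_completion"
      using j_add group_hom_onD(7)[OF hom_j] by auto
    then show "y + z \<in> ?A" by blast
    show "i (y + z) = i y + i z"
      unfolding yz(1) unfolding uv(3,4) by (simp add: i_j uv yz)
  qed
  obtain g where g: "group_hom_on (closure ?A) g" "continuous_on (closure ?A) g"
      "\<And>y. y \<in> ?A \<Longrightarrow> g y = i y"
    by (rule continuous_group_hom_extension[OF hom_i homeomorphism_cont2[OF i]
          completion_laws(1)]) blast
  have smul'_cont: "continuous_on UNIV (smul' a)" "continuous_on UNIV (\<lambda>a. smul' a y)" for a y
    using semi unfolding semitopological_module_on_def right_topological_module_on_def by auto
  have smul'_closure: "smul' a y \<in> closure ?A" if "y \<in> closure ?A" for a y
  proof -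
    have "smul' a ` closure ?A \<subseteq> closure ?A"
    proof (rule image_closure_subset)
      show "smul' a ` ?A \<subseteq> closure ?A"
        using j_smul cmult_mem_semi_completion closure_subset[of ?A] by fastforce
    qed (auto intro: continuous_on_subset[OF smul'_cont(1)])
    then show ?thesis using that by blast
  qed
  have g_smul': "g (smul' a y) = a \<star> g y" if y: "y \<in> closure ?A" for a y
  proof (rule continuous_agree_on_dense[OF _ _ _ y])
    show "continuous_on (closure ?A) (\<lambda>y. g (smul' a y))"
      using smul'_closure continuous_on_subset[OF smul'_cont(1)]
      by (intro continuous_on_compose2[OF g(2)]) auto
    show "continuous_on (closure ?A) (\<lambda>y. a \<star> g y)"
      by (rule cmult_continuous_compose[OF g(2)])
    fix y assume "y \<in> ?A"
    then obtain u where u: "u \<in> semi_completion" "y = j u" by blast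
    then show "g (smul' a y) = a \<star> g y"
      using cmult_mem_semi_completion[OF u(1)] by (simp add: j_smul g(3) i_j)
  qed
  have g_mem: "g y \<in> semi_completion" if y: "y \<in> closure ?A" for y
  proof -
    have "continuous_on UNIV (\<lambda>a. g (smul' a y))"
      using smul'_closure[OF y] by (intro continuous_on_compose2[OF g(2) smul'_cont(2)]) auto
    then show ?thesis
      by (simp add: mem_semi_completion g_smul'[OF y])
  qed
  have "j (g y) = y" if y: "y \<in> closure ?A" for y
  proof (rule continuous_agree_on_dense[OF _ _ _ y])
    show "continuous_on (closure ?A) (\<lambda>y. j (g y))"
      using g_mem by (intro continuous_on_compose2[OF homeomorphism_cont1[OF i] g(2)]) auto
  qed (auto simp: g(3) i_j)
  then have "closure ?A \<subseteq> ?A"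
    using g_mem by (metis imageI subsetI)
  then show ?thesis
    using closure_subset_eq by blast
qed

text \<open>
  Neighbourhoods \<open>V\<close> and \<open>M\<close> with \<open>V * M \<subseteq> U'\<close> in the original module give
  \<open>V \<star> W \<subseteq> closure U'\<close> in the completion, where \<open>W\<close> is open with trace inside \<open>M\<close>: points of the open
  set \<open>W\<close> are limits of points of \<open>W\<close> in the dense submodule.
\<close>

lemma cmult_jointly_continuous_at_zero:
  assumes top: "topological_module_on UNIV smul" and U: "open U" "0 \<in> U"
  shows "\<exists>V W. open V \<and> 0 \<in> V \<and> open W \<and> 0 \<in> W \<and> (\<forall>a\<in>V. \<forall>u\<in>W. a \<star> u \<in> U)"
proof -
  obtain i where i: "\<And>x. i (e x) = x" "continuous_on (range e) i" "continuous_on UNIV e"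
    by (rule embedding_inverse) blast
  obtain U' where U': "open U'" "0 \<in> U'" "closure U' \<subseteq> U"
    by (rule zero_neighborhood_closure[OF U])
  have "continuous_on UNIV (\<lambda>p. e (case p of (a, x) \<Rightarrow> smul a x))"
    using top unfolding topological_module_on_def
    by (intro continuous_on_compose2[OF i(3)]) auto
  then have "open ((\<lambda>p. e (case p of (a, x) \<Rightarrow> smul a x)) -` U')"
    by (rule open_vimage[OF U'(1)])
  moreover have "smul 0 0 = 0"
    using smul_laws(1)[of 0 0 0] by simp
  then have "(0, 0) \<in> (\<lambda>p. e (case p of (a, x) \<Rightarrow> smul a x)) -` U'"
    using U'(2) group_hom_onD(2)[OF hom_e] by simp
  ultimately obtain V M where VM: "open V" "open M" "(0, 0) \<in> V \<times> M"
      "V \<times> M \<subseteq> (\<lambda>p. e (case p of (a, x) \<Rightarrow> smul a x)) -` U'"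
    by (rule open_prod_elim)
  obtain W where W: "open W" "0 \<in> W" "\<forall>u\<in>range e. u \<in> W \<longrightarrow> i u \<in> M"
  proof -
    have "0 \<in> range e" "i 0 \<in> M"
      using group_hom_onD(2)[OF hom_e] i(1)[of 0] VM(3) by (metis rangeI, simp)
    then show thesis
      using i(2) VM(2) that unfolding continuous_on_topological by blast
  qed
  have "a \<star> u \<in> U" if "a \<in> V" "u \<in> W" for a u
  proof -
    have "u \<in> closure (W \<inter> range e)"
      using open_Int_closure_subset[OF W(1), of "range e"] that(2) completion_laws(3) by auto
    moreover have "(\<star>) a ` closure (W \<inter> range e) \<subseteq> closure U'"
    proof (rule image_closure_subset)
      show "(\<star>) a ` (W \<inter> range e) \<subseteq> closure U'"
      proof
        fix v assume "v \<in> (\<star>) a ` (W \<inter> range e)"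
        then obtain x where "e x \<in> W" "v = e (smul a x)"
          by (auto simp: cmult_e)
        then have "v \<in> U'"
          using W(3) i(1) VM(4) that(1) by fastforce
        then show "v \<in> closure U'"
          using closure_subset by blast
      qed
    qed (auto intro: continuous_on_subset[OF cmult_continuous])
    ultimately show ?thesis
      using U'(3) by blast
  qed
  then show ?thesis
    using VM W by blast
qed

theorem topological_completion:
  assumes top: "topological_module_on UNIV smul"
  shows "semi_completion = UNIV \<and> topological_module_on UNIV (completion_smult e smul)"
proof -
  have cont: "continuous_on UNIV (\<lambda>a. a \<star> u)" for u
  proof (rule continuous_on_group_homI[OF cmult_hom_left])
    fix U :: "'c set" assume U: "open U" "0 \<in> U"
    obtain U' where U': "open U'" "0 \<in> U'" "\<forall>x\<in>U'. \<forall>y\<in>U'. x - y \<in> U"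
      by (rule zero_neighborhood_diff[OF U])
    obtain V W where VW: "open V" "0 \<in> V" "open W" "0 \<in> W" "\<forall>a\<in>V. \<forall>u\<in>W. a \<star> u \<in> U'"
      using cmult_jointly_continuous_at_zero[OF top U'(1,2)] by blast
    \<comment> \<open>approximate \<open>u\<close> by some \<open>e x\<close>, whose orbit map is continuous, with an error in \<open>W\<close>\<close>
    have "u \<in> closure (range e)" "open {v. v - u \<in> W}" "u \<in> {v. v - u \<in> W}"
      using VW(3,4) open_translation_preimage(1) completion_laws(3) by auto
    then obtain x where x: "e x - u \<in> W"
      unfolding closure_iff_nhds_not_empty by blast
    have "continuous_on (UNIV \<times> UNIV) (\<lambda>(a, x). smul a x)"
      using top by (simp add: topological_module_on_def)
    from continuous_on_compose2[OF this, of UNIV "\<lambda>a. (a, x)"]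
    have "continuous_on UNIV (\<lambda>a. smul a x)"
      by (simp add: continuous_on_Pair)
    moreover have "continuous_on UNIV e"
      by (rule embedding_inverse)
    ultimately have "continuous_on UNIV (\<lambda>a. a \<star> e x)"
      unfolding cmult_e using continuous_on_compose2 by blast
    then have "open ((\<lambda>a. a \<star> e x) -` U')"
      by (rule open_vimage[OF U'(1)])
    moreover have "a \<star> u \<in> U" if "a \<in> V \<inter> (\<lambda>a. a \<star> e x) -` U'" for a
    proof -
      have "a \<star> e x - a \<star> (e x - u) \<in> U"
        using that x VW(5) U'(3) by blast
      then show ?thesis
        using group_hom_onD(4)[OF cmult_hom_right] by simp
    qed
    moreover have "0 \<in> V \<inter> (\<lambda>a. a \<star> e x) -` U'"
      using VW(2) U'(2) group_hom_onD(2)[OF cmult_hom_left] by simp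
    ultimately show "\<exists>N. open N \<and> 0 \<in> N \<and> (\<forall>a\<in>N \<inter> UNIV. a \<star> u \<in> U)"
      using VW(1) by (intro exI[of _ "V \<inter> (\<lambda>a. a \<star> e x) -` U'"]) auto
  qed
  have "continuous_on UNIV (\<lambda>(a, u). a \<star> u)"
    by (rule continuous_on_biadditiveI[OF cmult_hom_left cont cmult_hom_right cmult_continuous
          cmult_jointly_continuous_at_zero[OF top]])
  then show ?thesis
    using cont left_module_on_UNIV unfolding topological_module_on_def
    by (auto simp: mem_semi_completion)
qed

text \<open>
  Each scalar acts continuously, so the orbit maps of the sequence converge pointwise to the orbit
  map of its limit, and the result on Baire groups applies.
\<close>

theorem semitopological_completion_sequentially_closed:
  assumes "baire_space TYPE('r)"
  shows "sequentially_closed semi_completion"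
  unfolding sequentially_closed_def
proof (intro allI impI)
  fix s l assume s: "\<forall>n. s n \<in> semi_completion" "s \<longlonglongrightarrow> l"
  have "continuous_on UNIV (\<lambda>a. a \<star> l)"
  proof (rule baire_pointwise_limit_continuous[OF assms])
    show "group_hom_on UNIV (\<lambda>a. a \<star> s n)" for n
      by (rule cmult_hom_left)
    show "continuous_on UNIV (\<lambda>a. a \<star> s n)" for n
      using s(1) by (simp add: mem_semi_completion)
    show "(\<lambda>n. a \<star> s n) \<longlonglongrightarrow> a \<star> l" for a
      by (rule continuous_on_tendsto_compose[OF cmult_continuous s(2)]) auto
  qed
  then show "l \<in> semi_completion"
    by (simp add: mem_semi_completion)
qed

end

theorem theorem3p1:
  fixes smul :: "'r::{ring, monoid_mult, topological_ab_group_add, topological_semigroup_mult, t2_space}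
                 \<Rightarrow> 'x::{topological_ab_group_add, t2_space} \<Rightarrow> 'x"
    and e :: "'x \<Rightarrow> 'c::{topological_ab_group_add, uniform_topological_group_add, t2_space}"
  assumes "semitopological_module_on UNIV smul"
    and "raikov_completion e"
  shows "semitopological_module_on (semitopological_completion e smul) (completion_smult e smul) \<and>
    (\<forall>(smul' :: 'r \<Rightarrow> 'y::{topological_ab_group_add, t2_space} \<Rightarrow> 'y) j.
       semitopological_module_on UNIV smul' \<longrightarrow>
       submodule_embedding (semitopological_completion e smul) (completion_smult e smul) UNIV smul' j \<longrightarrow>
       closed (j ` semitopological_completion e smul)) \<and>
    (topological_module_on UNIV smul \<longrightarrow>
       semitopological_completion e smul = UNIV \<and>
       topological_module_on (semitopological_completion e smul) (completion_smult e smul)) \<and>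
    (baire_space TYPE('r) \<longrightarrow> omega_narrow TYPE('r) \<longrightarrow>
       sequentially_closed (semitopological_completion e smul))"
proof -
  interpret right_topological_module_completion smul e
    using assms by unfold_locales (auto simp: semitopological_module_on_def)
  show ?thesis
    using semitopological_completion_is_semitopological
      semitopological_completion_closed[where ?'y = 'y] topological_completion
      semitopological_completion_sequentially_closed
    by auto
qed

end
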